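(* Suppose that the reference node $0$ is incident to exactly one edge of $\hat{\mathcal{G}}$, and let $x_0$ be the inverse susceptance of that edge. Let $(X^*,z^* )$ be a minimizer of $$\min_{X\in\mathbb{R}^{N\times N},\ z\in\mathcal{Z}}\ \operatorname{Tr}(\tilde W X)\quad\text{subject to}\quad \tilde L(z)X=I_N$$ with budget $K=N$ (radial network). Then $$h_i\le X^*_{ii}\le f\qquad\text{for all } i\in\mathcal{V}_r,$$ $$x_0\le X^*_{ij}\le f-x_{\min}\qquad\text{for all } i,j\in\mathcal{V}_r,\ i\ne j.$$
   Context: Let $\hat{\mathcal{G}}=(\mathcal{V},\hat{\mathcal{E}})$ be an undirected graph with nodes $\mathcal{V}=\{0,1,\dots,N\}$ and candidate lines (edges) $\hat{\mathcal{E}}$; each line $(i,j)\in\hat{\mathcal{E}}$ has susceptance $b_{ij}>0$. Node $0$ is the reference node and $\mathcal{V}_r=\mathcal{V}\setminus\{0\}=\{1,\dots,N\}$. For each line $(i,j)$ (with an arbitrary fixed orientation), $a_{ij}\in\mathbb{R}^N$ is the vector indexed by $\mathcal{V}_r$ with $n$-th entry $+1$ if $n=i$, $-1$ if $n=j$, and $0$ otherwise. For the budget $K$, $\mathcal{Z}=\{z\in\{0,1\}^{|\hat{\mathcal{E}}|}:\ \sum_{m\in\hat{\mathcal{E}}}z_m\le K\}$; here $K=N$. For $z\in\mathcal{Z}$, $\tilde L(z)=\sum_{(i,j)\in\hat{\mathcal{E}}}z_{ij}b_{ij}a_{ij}a_{ij}^\top\in\mathbb{R}^{N\times N}$ is the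 reduced susceptance Laplacian of the graph formed by the selected lines. $W$ is the Laplacian matrix of a connected graph on $\mathcal{V}$ with non-negative edge weights, and $\tilde W\in\mathbb{R}^{N\times N}$ is obtained from $W$ by deleting the row and column of the reference node $0$. Let $\mathcal{G}_r=(\mathcal{V},\hat{\mathcal{E}}_r)$ be the graph with the same nodes and edges as $\hat{\mathcal{G}}$ but with edge weights equal to the inverse susceptances $x_{ij}=b_{ij}^{-1}$. Define $x_{\min}=\min_{(i,j)\in\hat{\mathcal{E}}_r}x_{ij}$; $f$ is the sum of the edge weights of a maximum spanning tree of $\mathcal{G}_r$; and for $i\in\mathcal{V}_r$, $h_i$ is the sum of edge weights along a shortest (minimum-weight) path from $i$ to node $0$ in $\mathcal{G}_r$. *)

theory Defs
  imports "HOL-Analysis.Analysis"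
begin

text \<open>
  A finite simple graph on the vertex set \<^term>\<open>UNIV :: 'v set\<close> is given by its set of edges, each
  edge being the two-element set of its end points.
\<close>

definition simple_graph :: "'v set set \<Rightarrow> bool" where
  "simple_graph E \<longleftrightarrow> (\<forall>e\<in>E. card e = 2)"

definition adj_list :: "'v set set \<Rightarrow> 'v list \<Rightarrow> bool" where
  "adj_list E p \<longleftrightarrow> successively (\<lambda>u v. {u, v} \<in> E) p"

definition is_path :: "'v set set \<Rightarrow> 'v \<Rightarrow> 'v list \<Rightarrow> 'v \<Rightarrow> bool" where
  "is_path E u p v \<longleftrightarrow> p \<noteq> [] \<and> hd p = u \<and> last p = v \<and> distinct p \<and> adj_list E p"

definition is_cycle :: "'v set set \<Rightarrow> 'v list \<Rightarrow> bool" where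
  "is_cycle E p \<longleftrightarrow> 3 \<le> length p \<and> distinct p \<and> adj_list E p \<and> {last p, hd p} \<in> E"

definition connected_graph :: "'v set set \<Rightarrow> bool" where
  "connected_graph E \<longleftrightarrow> (\<forall>u v. \<exists>p. is_path E u p v)"

definition spanning_tree :: "'v set set \<Rightarrow> 'v set set \<Rightarrow> bool" where
  "spanning_tree E T \<longleftrightarrow> T \<subseteq> E \<and> connected_graph T \<and> (\<nexists>p. is_cycle T p)"

definition max_spanning_tree_weight :: "'v set set \<Rightarrow> ('v set \<Rightarrow> real) \<Rightarrow> real" where
  "max_spanning_tree_weight E x = sum x (arg_max (sum x) (spanning_tree E))"

definition path_weight :: "('v set \<Rightarrow> real) \<Rightarrow> 'v list \<Rightarrow> real" where
  "path_weight x p = (\<Sum>k<length p - 1. x {p ! k, p ! Suc k})"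

definition shortest_path_weight ::
  "'v set set \<Rightarrow> ('v set \<Rightarrow> real) \<Rightarrow> 'v \<Rightarrow> 'v \<Rightarrow> real" where
  "shortest_path_weight E x u v = path_weight x (arg_min (path_weight x) (\<lambda>p. is_path E u p v))"

definition laplacian :: "'v set set \<Rightarrow> ('v set \<Rightarrow> real) \<Rightarrow> real ^ 'v ^ 'v" where
  "laplacian E w =
    (\<chi> u v. if u = v then (\<Sum>e\<in>{e\<in>E. u \<in> e}. w e)
            else if {u, v} \<in> E then - w {u, v} else 0)"

text \<open>
  From here on the vertices are \<^typ>\<open>'n option\<close>: \<^term>\<open>None\<close> is the reference node 0, the
  remaining nodes are \<^term>\<open>Some n\<close> for \<^term>\<open>n :: 'n\<close>, and the number of the latter is
  \<^term>\<open>CARD('n)\<close>.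
\<close>

definition reduced_matrix :: "real ^ 'n option ^ 'n option \<Rightarrow> real ^ 'n ^ 'n" where
  "reduced_matrix W = (\<chi> i j. W $ Some i $ Some j)"

definition incidence_vec :: "'n option \<Rightarrow> 'n option \<Rightarrow> real ^ 'n" where
  "incidence_vec i j = (\<chi> n. if Some n = i then 1 else if Some n = j then -1 else 0)"

definition orientation :: "'v set set \<Rightarrow> ('v set \<Rightarrow> 'v) \<Rightarrow> ('v set \<Rightarrow> 'v) \<Rightarrow> bool" where
  "orientation E src dst \<longleftrightarrow> (\<forall>e\<in>E. e = {src e, dst e})"

text \<open>
  The number of columns of \<^const>\<open>columnvector\<close> is polymorphic; it has to be fixed to 1 for the
  product below to be the outer product of the incidence vector with itself.
\<close>

definition reduced_susceptance_laplacian ::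
  "'n option set set \<Rightarrow> ('n option set \<Rightarrow> 'n option) \<Rightarrow> ('n option set \<Rightarrow> 'n option) \<Rightarrow>
   ('n option set \<Rightarrow> real) \<Rightarrow> ('n option set \<Rightarrow> real) \<Rightarrow> real ^ 'n ^ 'n" where
  "reduced_susceptance_laplacian E src dst b z =
    (\<Sum>e\<in>E. (z e * b e) *\<^sub>R
      ((columnvector (incidence_vec (src e) (dst e)) :: real ^ 1 ^ 'n) **
       rowvector (incidence_vec (src e) (dst e))))"

text \<open>Selections are extensional functions, so that they are determined by their values on the edges.\<close>

definition selections :: "'v set set \<Rightarrow> nat \<Rightarrow> ('v set \<Rightarrow> real) set" where
  "selections E K = {z \<in> E \<rightarrow>\<^sub>E {0, 1}. (\<Sum>e\<in>E. z e) \<le> real K}"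

definition feasible ::
  "'n option set set \<Rightarrow> ('n option set \<Rightarrow> 'n option) \<Rightarrow> ('n option set \<Rightarrow> 'n option) \<Rightarrow>
   ('n option set \<Rightarrow> real) \<Rightarrow> nat \<Rightarrow> (real ^ 'n ^ 'n) \<times> ('n option set \<Rightarrow> real) \<Rightarrow> bool" where
  "feasible E src dst b K = (\<lambda>(X, z).
     z \<in> selections E K \<and> reduced_susceptance_laplacian E src dst b z ** X = mat 1)"

definition objective ::
  "real ^ 'n ^ 'n \<Rightarrow> (real ^ 'n ^ 'n) \<times> ('n option set \<Rightarrow> real) \<Rightarrow> real" where
  "objective W = (\<lambda>(X, z). trace (W ** X))"

end

theory Submission
  imports Defs
begin

text \<open>
  Let \<open>T\<close> be the set of selected edges and \<open>N\<close> the number of nodes other than the reference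
  node 0. The range of the reduced Laplacian lies in the span of the incidence vectors \<open>a\<^sub>e\<close> of the
  edges of \<open>T\<close>. As it is invertible and \<open>T\<close> has at most \<open>N\<close> edges, these vectors form a
  basis of the space of dimension \<open>N\<close>. All that is needed about trees is read off from this basis.

  Along a path from \<open>u\<close> to \<open>v\<close> the incidence vectors, with signs for the direction of travel,
  telescope to the difference of the unit vectors of \<open>u\<close> and \<open>v\<close> (\<open>sum_crossing_inc\<close>), where node 0
  has the zero vector. Hence the end points determine which edges a path uses and in which
  direction (\<open>crossing_path_unique\<close>). So \<open>T\<close> has no cycle. It is connected, because the indicator
  of a component would otherwise give a nonzero vector orthogonal to the whole basis. Thus
  \<open>T\<close> is a spanning tree of the candidate graph.

  Let \<open>s\<^sub>i(e) \<in> {-1, 0, 1}\<close> be the sign with which the path from \<open>i\<close> to 0 uses \<open>e\<close>. Comparing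
  coefficients in \<open>L X = I\<close> yields \<open>X\<^sub>i\<^sub>j = (\<Sum>e\<in>T. x\<^sub>e s\<^sub>i(e) s\<^sub>j(e))\<close>
  (\<open>resistance_matrix_entry\<close>). Two paths to the same node never use an edge in opposite directions
  (\<open>crossing_mult_nonneg\<close>), so \<open>X\<^sub>i\<^sub>j\<close> is the weight of the edges that both paths share.
  On the diagonal this is the weight of a path, hence at least the weight of a shortest path and at
  most that of \<open>T\<close>. Off the diagonal, the only edge at node 0 is always shared, and some edge
  of \<open>T\<close> is not, since otherwise both paths would have the same expansion in the basis and
  thus the same start. The weight of \<open>T\<close> is at most that of a maximum spanning tree.
\<close>

section \<open>Extremal trees and paths\<close>

lemma sum_le_max_spanning_tree_weight:
  fixes E :: "'v::finite set set"
  assumes "spanning_tree E T"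
  shows "sum x T \<le> max_spanning_tree_weight E x"
proof -
  let ?S = "{T. spanning_tree E T}"
  have ne: "sum x ` ?S \<noteq> {}"
    using assms by auto
  obtain M where M: "spanning_tree E M" "sum x M = Max (sum x ` ?S)"
    using Max_in[OF _ ne] by fastforce
  have max: "sum x T' \<le> sum x M" if "spanning_tree E T'" for T'
    unfolding M(2) using that by (intro Max_ge) auto
  have "sum x (arg_max (sum x) (spanning_tree E)) = sum x M"
    using M(1) max by (rule arg_max_equality)
  then show ?thesis
    using max[OF assms] by (simp add: max_spanning_tree_weight_def)
qed

lemma shortest_path_weight_le:
  fixes E :: "'v::finite set set"
  assumes "is_path E u p v"
  shows "shortest_path_weight E x u v \<le> path_weight x p"
proof -
  let ?P = "{p. is_path E u p v}"
  have "finite ?P"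
    by (rule finite_subset[OF _ finite_subset_distinct[of UNIV]]) (auto simp: is_path_def)
  then have "path_weight x (arg_min_on (path_weight x) ?P) \<le> path_weight x p"
    using assms by (intro arg_min_least) auto
  then show ?thesis
    by (simp add: shortest_path_weight_def arg_min_on_def)
qed

section \<open>Traversals of an edge by a path\<close>

text \<open>
  The function takes the two ends of an edge and not the edge itself, which keeps it independent
  of the graph and of the orientation.
\<close>

fun net_traversals :: "'v \<Rightarrow> 'v \<Rightarrow> 'v list \<Rightarrow> real" where
  "net_traversals s t (u # v # p) =
     (if u = s \<and> v = t then 1 else if u = t \<and> v = s then -1 else 0) + net_traversals s t (v # p)"
| "net_traversals s t p = 0"

lemma net_traversals_eq_0:
  "s \<notin> set p \<or> t \<notin> set p \<Longrightarrow> net_traversals s t p = 0"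
proof (induction s t p rule: net_traversals.induct)
  case (1 s t u v p)
  have "\<not> (u = s \<and> v = t)" "\<not> (u = t \<and> v = s)"
    using 1(2) by auto
  moreover have "net_traversals s t (v # p) = 0"
    using 1(2) by (intro 1(1)) auto
  ultimately show ?case
    by simp
qed simp_all

text \<open>
  A path visits a node only once, so after one passage through an edge it cannot return to it.
  The decomposition of the list is kept because directions are compared below by way of
  the remainder of the path after the edge.
\<close>

lemma net_traversals_cases:
  assumes "distinct p"
  obtains "net_traversals s t p = 0"
  | q r where "net_traversals s t p = 1" "p = q @ s # t # r"
  | q r where "net_traversals s t p = -1" "p = q @ t # s # r"
proof -
  have "net_traversals s t p = 0 \<or>
    net_traversals s t p = 1 \<and> (\<exists>q r. p = q @ s # t # r) \<or>
    net_traversals s t p = -1 \<and> (\<exists>q r. p = q @ t # s # r)"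
    using assms
  proof (induction s t p rule: net_traversals.induct)
    case (1 s t u v p)
    show ?case
    proof (cases "{u, v} = {s, t}")
      case True
      then have zero: "net_traversals s t (v # p) = 0"
        using 1 by (intro net_traversals_eq_0) (auto simp: doubleton_eq_iff)
      have "s \<noteq> t"
        using 1 True by auto
      consider "u = s" "v = t" | "u = t" "v = s"
        using True by (auto simp: doubleton_eq_iff)
      then show ?thesis
      proof cases
        case 1
        then have "u # v # p = [] @ s # t # p"
          by simp
        moreover have "net_traversals s t (u # v # p) = 1"
          using 1 zero by simp
        ultimately show ?thesis
          by blast
      next
        case 2
        then have "u # v # p = [] @ t # s # p"
          by simp
        moreover have "net_traversals s t (u # v # p) = -1"
          using 2 zero \<open>s \<noteq> t\<close> by simp
        ultimately show ?thesis
          by blast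
      qed
    next
      case False
      then have "net_traversals s t (u # v # p) = net_traversals s t (v # p)"
        by auto
      moreover have "\<exists>q r. u # v # p = q @ a # c # r" if "\<exists>q r. v # p = q @ a # c # r" for a c
        using that by (metis append_Cons)
      moreover have "distinct (v # p)"
        using 1 by simp
      ultimately show ?thesis
        using "1.IH" by presburger
    qed
  qed auto
  then show ?thesis
    using that by blast
qed

lemma adj_list_Cons_Cons: "adj_list T (u # v # p) \<longleftrightarrow> {u, v} \<in> T \<and> adj_list T (v # p)"
  by (simp add: adj_list_def)

lemma adj_list_suffix: "adj_list T (q @ p) \<Longrightarrow> adj_list T p"
  by (simp add: adj_list_def successively_append_iff)

lemma path_weight_Cons_Cons: "path_weight x (u # v # p) = x {u, v} + path_weight x (v # p)"
  by (simp add: path_weight_def sum.lessThan_Suc_shift del: sum.lessThan_Suc)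

lemma is_path_suffix: "is_path T u (q @ v # p) w \<Longrightarrow> is_path T v (v # p) w"
  by (auto simp: is_path_def dest: adj_list_suffix)

locale oriented_graph =
  fixes T :: "'v::finite set set" and src dst :: "'v set \<Rightarrow> 'v"
  assumes simple: "simple_graph T" and orientation: "orientation T src dst"
begin

lemma edge_ends: "e \<in> T \<Longrightarrow> e = {src e, dst e} \<and> src e \<noteq> dst e"
proof
  assume e: "e \<in> T"
  then show eq: "e = {src e, dst e}"
    using orientation unfolding orientation_def by blast
  have "card e = 2"
    using e simple by (simp add: simple_graph_def)
  then show "src e \<noteq> dst e"
    by (subst (asm) eq) auto
qed

abbreviation crossing :: "'v list \<Rightarrow> 'v set \<Rightarrow> real" where
  "crossing p e \<equiv> net_traversals (src e) (dst e) p"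

text \<open>
  Squaring forgets the direction. Besides the diagonal entries of the inverse Laplacian, this
  also gives the number of edges of a path, with the weight that is constantly 1.
\<close>

lemma path_weight_eq_sum_crossing:
  assumes "adj_list T p" and "distinct p"
  shows "path_weight x p = (\<Sum>e\<in>T. x e * (crossing p e)\<^sup>2)"
  using assms
proof (induction p rule: induct_list012)
  case (3 u v p)
  have eq: "x e * (crossing (u # v # p) e)\<^sup>2 =
      (if e = {u, v} then x {u, v} else 0) + x e * (crossing (v # p) e)\<^sup>2" if "e \<in> T" for e
  proof (cases "e = {u, v}")
    case True
    then have "crossing (v # p) e = 0"
      using edge_ends[OF that] 3 by (intro net_traversals_eq_0) (auto simp: doubleton_eq_iff)
    then show ?thesis
      using True edge_ends[OF that] by (auto simp: doubleton_eq_iff)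
  next
    case False
    then show ?thesis
      using edge_ends[OF that] by auto
  qed
  have "{u, v} \<in> T"
    using 3 by (simp add: adj_list_Cons_Cons)
  then show ?case
    using 3 eq by (simp add: path_weight_Cons_Cons adj_list_Cons_Cons sum.distrib)
qed (auto simp: path_weight_def)

end

section \<open>Incidence vectors that form a basis\<close>

text \<open>
  The unit vector of a node in reduced coordinates, in which the reference node is grounded and
  so gets the zero vector.
\<close>

definition node_vec :: "'n option \<Rightarrow> real ^ 'n" where
  "node_vec u = (\<chi> n. if Some n = u then 1 else 0)"

lemma node_vec_simps [simp]: "node_vec None = 0" "node_vec (Some i) = axis i 1"
  by (auto simp: node_vec_def vec_eq_iff axis_def)

lemma node_vec_inject: "node_vec u = node_vec v \<longleftrightarrow> u = v"
  by (cases u; cases v) (auto simp: axis_eq_axis)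

lemma incidence_vec_eq: "u \<noteq> v \<Longrightarrow> incidence_vec u v = node_vec u - node_vec v"
  by (auto simp: incidence_vec_def node_vec_def vec_eq_iff)

text \<open>
  Vectors in reduced coordinates are identified with potentials on all nodes that vanish at the
  reference node. The indicators of cuts below enter in this way.
\<close>

lemma inner_node_vec: "g None = 0 \<Longrightarrow> (\<chi> i. g (Some i)) \<bullet> node_vec u = g u"
  by (cases u) (auto simp: inner_axis)

locale incidence_basis = oriented_graph T src dst
  for T :: "'n::finite option set set" and src dst +
  assumes spanning: "span ((\<lambda>e. incidence_vec (src e) (dst e)) ` T) = (UNIV :: (real ^ 'n) set)"
    and card_le: "card T \<le> CARD('n)"
begin

abbreviation inc :: "'n option set \<Rightarrow> real ^ 'n" where
  "inc e \<equiv> incidence_vec (src e) (dst e)"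

lemma inc_eq: "e \<in> T \<Longrightarrow> inc e = node_vec (src e) - node_vec (dst e)"
  using edge_ends by (simp add: incidence_vec_eq)

text \<open>
  A spanning set with no more elements than the dimension is a basis. The same count also rules
  out that two edges share an incidence vector, so coefficients may be indexed by edges.
\<close>

lemma coefficients_unique:
  assumes "(\<Sum>e\<in>T. c e *\<^sub>R inc e) = (\<Sum>e\<in>T. d e *\<^sub>R inc e)" and "e \<in> T"
  shows "c e = d e"
proof -
  have "CARD('n) \<le> card (inc ` T)"
    using dim_le_card[of UNIV "inc ` T"] spanning by simp
  then have card: "card (inc ` T) = card T" "card (inc ` T) = CARD('n)"
    using card_le card_image_le[of T inc] by auto
  then have inj: "inj_on inc T"
    by (intro eq_card_imp_inj_on) auto
  have indep: "independent (inc ` T)"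
    using card spanning by (intro card_le_dim_spanning[of _ UNIV]) auto
  let ?k = "\<lambda>y. c (the_inv_into T inc y) - d (the_inv_into T inc y)"
  have "(\<Sum>y\<in>inc ` T. ?k y *\<^sub>R y) = (\<Sum>e\<in>T. (c e - d e) *\<^sub>R inc e)"
    by (simp add: sum.reindex[OF inj] the_inv_into_f_f[OF inj] cong: sum.cong)
  also have "\<dots> = 0"
    using assms(1) by (simp add: scaleR_left_diff_distrib sum_subtractf)
  finally have "?k (inc e) = 0"
    using assms(2) by (intro independentD[OF indep, of "inc ` T" ?k]) auto
  then show ?thesis
    by (simp add: the_inv_into_f_f[OF inj assms(2)])
qed

lemma orthogonal_imp_0:
  assumes "\<And>e. e \<in> T \<Longrightarrow> y \<bullet> inc e = 0"
  shows "y = 0"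
proof -
  have "orthogonal y y"
    by (rule orthogonal_to_span[of y "inc ` T"]) (use assms spanning in \<open>auto simp: orthogonal_def\<close>)
  then show ?thesis
    by (simp add: orthogonal_def)
qed

text \<open>
  The incidence vector of an edge, with the sign of the direction of travel, is the difference of
  the vectors of its two nodes in the order of travel, so the sum telescopes.
\<close>

lemma sum_crossing_inc:
  assumes "p \<noteq> []" and "adj_list T p"
  shows "(\<Sum>e\<in>T. crossing p e *\<^sub>R inc e) = node_vec (hd p) - node_vec (last p)"
  using assms
proof (induction p rule: induct_list012)
  case (3 u v p)
  have eq: "crossing (u # v # p) e *\<^sub>R inc e =
      (if e = {u, v} then node_vec u - node_vec v else 0) + crossing (v # p) e *\<^sub>R inc e"
    if e: "e \<in> T" for e
  proof (cases "e = {u, v}")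
    case True
    then consider "src e = u" "dst e = v" | "src e = v" "dst e = u"
      using edge_ends[OF e] by (metis doubleton_eq_iff)
    moreover have "u \<noteq> v"
      using True simple e by (auto simp: simple_graph_def)
    ultimately show ?thesis
      using True by cases (simp_all add: incidence_vec_eq algebra_simps)
  next
    case False
    then show ?thesis
      using edge_ends[OF e] by auto
  qed
  have "{u, v} \<in> T"
    using 3 by (simp add: adj_list_Cons_Cons)
  then show ?case
    using 3 eq by (simp add: adj_list_Cons_Cons sum.distrib)
qed auto

text \<open>
  Both paths expand the same vector in a basis. This replaces the combinatorial fact that paths
  in a tree are unique.
\<close>

lemma crossing_path_unique:
  assumes "is_path T u p v" and "is_path T u q v" and "e \<in> T"
  shows "crossing p e = crossing q e"
  by (rule coefficients_unique[OF _ assms(3)])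
     (use assms(1,2) in \<open>auto simp: is_path_def sum_crossing_inc\<close>)

text \<open>
  The nodes from which a given node can be reached form a component, so their indicator
  is constant along every edge. Shifted to vanish at the reference node, it becomes a
  vector orthogonal to all incidence vectors, hence zero, and the indicator is constant.
\<close>

lemma connected: "connected_graph T"
  unfolding connected_graph_def
proof (intro allI)
  fix u v
  define S where "S = {u. \<exists>p. is_path T u p v}"
  have step: "s \<in> S" if edge: "{s, t} \<in> T" and t: "t \<in> S" for s t
  proof -
    obtain p where p: "is_path T t p v"
      using t by (auto simp: S_def)
    show ?thesis
    proof (cases "s \<in> set p")
      case True
      then obtain q r where "p = q @ s # r"
        by (auto simp: in_set_conv_decomp)
      then show ?thesis
        using p is_path_suffix by (fastforce simp: S_def)
    next
      case False
      then have "is_path T s (s # p) v"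
        using p edge by (cases p) (auto simp: is_path_def adj_list_Cons_Cons)
      then show ?thesis
        by (auto simp: S_def)
    qed
  qed
  have "is_path T v [v] v"
    by (simp add: is_path_def adj_list_def)
  then have "v \<in> S"
    by (auto simp: S_def)
  define g :: "'n option \<Rightarrow> real" where "g w = indicator S w - indicator S None" for w
  have g_None: "g None = 0"
    by (simp add: g_def)
  have "(\<chi> i. g (Some i)) = 0"
  proof (rule orthogonal_imp_0)
    fix e assume e: "e \<in> T"
    then have "src e \<in> S \<longleftrightarrow> dst e \<in> S"
      using step[of "src e" "dst e"] step[of "dst e" "src e"] edge_ends[OF e]
      by (metis insert_commute)
    then have "g (src e) = g (dst e)"
      by (simp add: g_def indicator_def)
    then show "(\<chi> i. g (Some i)) \<bullet> inc e = 0"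
      using e by (simp add: inc_eq inner_diff_right inner_node_vec g_None)
  qed
  then have "g w = 0" for w
    using g_None by (cases w) (auto simp: vec_eq_iff)
  then have "g u = g v"
    by simp
  then have "indicator S u = (indicator S v :: real)"
    by (simp add: g_def)
  then show "\<exists>p. is_path T u p v"
    using \<open>v \<in> S\<close> by (auto simp: S_def indicator_def split: if_splits)
qed

text \<open>
  A cycle without its closing edge would be a path of at least two edges with the same ends as
  that single edge, so the two would cross the same edges and could not differ in length.
\<close>

lemma acyclic: "\<not> is_cycle T p"
proof
  assume cyc: "is_cycle T p"
  then have p: "is_path T (hd p) p (last p)" and edge: "{last p, hd p} \<in> T"
    by (auto simp: is_cycle_def is_path_def)
  have len: "3 \<le> length p"
    using cyc by (simp add: is_cycle_def)
  have "hd p \<noteq> last p"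
    using edge simple by (auto simp: simple_graph_def)
  then have q: "is_path T (hd p) [hd p, last p] (last p)"
    using edge by (simp add: is_path_def adj_list_def insert_commute)
  have "path_weight (\<lambda>_. 1) p = path_weight (\<lambda>_. 1) [hd p, last p]"
    using p q by (simp add: is_path_def path_weight_eq_sum_crossing crossing_path_unique[OF p q]
      del: net_traversals.simps)
  then show False
    using len by (simp add: path_weight_def)
qed

text \<open>
  Suppose one path runs from \<open>s\<close> to \<open>t\<close> and the other from \<open>t\<close> to \<open>s\<close>. The remainders of both
  from \<open>t\<close> on have the same ends, yet only the second of them crosses the edge.
\<close>

lemma crossing_mult_nonneg:
  assumes p: "is_path T u p w" and q: "is_path T v q w" and e: "e \<in> T"
  shows "0 \<le> crossing p e * crossing q e"
proof -
  have opposite: False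
    if pst: "p = p1 @ s # t # p2" and qts: "q = q1 @ t # s # q2"
      and st: "(s = src e \<and> t = dst e) \<or> (s = dst e \<and> t = src e)"
    for p1 p2 q1 q2 s t
  proof -
    have p': "is_path T t (t # p2) w"
      using is_path_suffix[of T u "p1 @ [s]" t p2 w] p pst by simp
    have q': "is_path T t (t # s # q2) w"
      using is_path_suffix q unfolding qts .
    have "s \<notin> set (t # p2)" "t \<notin> set (s # q2)"
      using p q pst qts by (auto simp: is_path_def)
    then have "crossing (t # p2) e = 0" "crossing (s # q2) e = 0"
      using st by (auto intro: net_traversals_eq_0 simp del: set_simps)
    then show False
      using crossing_path_unique[OF p' q' e] st by (auto split: if_splits)
  qed
  have "distinct p" "distinct q"
    using p q by (auto simp: is_path_def)
  then show ?thesis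
  proof (cases rule: net_traversals_cases[where s="src e" and t="dst e",
        case_product net_traversals_cases[where s="src e" and t="dst e"]])
    \<comment> \<open>The two numbers in a case name refer to the signs 0, 1, -1 of \<open>p\<close> and \<open>q\<close>, in this order.\<close>
    case ("2_3" p1 p2 q1 q2)
    then show ?thesis
      using opposite by blast
  next
    case ("3_2" p1 p2 q1 q2)
    then show ?thesis
      using opposite by blast
  qed auto
qed

text \<open>
  The vector with all entries 1 is the cut between the reference node and the rest. Taking the inner
  product with the expansion of a path to the reference node leaves only the crossing of \<open>e0\<close> and
  gives 1. Hence \<open>e0\<close> is in \<open>T\<close>, and all such paths cross it with the same sign.
\<close>

lemma crossing_only_edge_at_root:
  assumes e0: "\<And>e. e \<in> T \<Longrightarrow> None \<in> e \<Longrightarrow> e = e0"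
  obtains c where "e0 \<in> T" "c \<noteq> 0" "\<And>i p. is_path T (Some i) p None \<Longrightarrow> crossing p e0 = c"
proof -
  define g :: "'n option \<Rightarrow> real" where "g w = (if w = None then 0 else 1)" for w
  define y :: "real ^ 'n" where "y = (\<chi> i. g (Some i))"
  have y: "y \<bullet> node_vec u = g u" for u
    unfolding y_def by (rule inner_node_vec) (simp add: g_def)
  have zero: "y \<bullet> inc e = 0" if e: "e \<in> T" "e \<noteq> e0" for e
  proof -
    have "None \<notin> e"
      using e0 e by blast
    then have "src e \<noteq> None" "dst e \<noteq> None"
      using edge_ends[OF e(1)] by (metis insert_iff)+
    then show ?thesis
      by (simp add: inc_eq[OF e(1)] inner_diff_right y g_def del: not_None_eq)
  qed
  have one: "(if e0 \<in> T then crossing p e0 * (y \<bullet> inc e0) else 0) = 1"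
    if p: "is_path T (Some i) p None" for i p
  proof -
    have "(if e0 \<in> T then crossing p e0 * (y \<bullet> inc e0) else 0) =
        (\<Sum>e\<in>T. if e = e0 then crossing p e0 * (y \<bullet> inc e0) else 0)"
      by simp
    also have "\<dots> = (\<Sum>e\<in>T. crossing p e * (y \<bullet> inc e))"
      by (rule sum.cong) (auto simp: zero)
    also have "\<dots> = y \<bullet> (\<Sum>e\<in>T. crossing p e *\<^sub>R inc e)"
      by (simp add: inner_sum_right)
    also have "\<dots> = y \<bullet> node_vec (Some i)"
      using p by (simp add: is_path_def sum_crossing_inc del: node_vec_simps(2))
    finally show ?thesis
      by (simp add: y g_def del: node_vec_simps)
  qed
  \<comment> \<open>Some path to the root exists, since the index type is nonempty.\<close>
  obtain i p where "is_path T (Some (i :: 'n)) p None"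
    using connected by (meson connected_graph_def)
  from one[OF this] have "e0 \<in> T" "y \<bullet> inc e0 \<noteq> 0"
    by (auto split: if_splits)
  then show ?thesis
    using one that[of "1 / (y \<bullet> inc e0)"] by (simp add: field_simps)
qed

end

section \<open>The reduced Laplacian\<close>

lemma outer_product_mult_vec:
  fixes a y :: "real ^ 'n"
  shows "((columnvector a :: real ^ 1 ^ 'n) ** rowvector a) *v y = (y \<bullet> a) *\<^sub>R a"
  by (simp add: vec_eq_iff matrix_matrix_mult_def matrix_vector_mult_def columnvector_def
      rowvector_def inner_vec_def sum_distrib_left mult_ac)

lemma reduced_susceptance_laplacian_mult_vec:
  fixes y :: "real ^ 'n"
  shows "reduced_susceptance_laplacian E src dst b z *v y =
    (\<Sum>e\<in>E. (z e * b e * (y \<bullet> incidence_vec (src e) (dst e))) *\<^sub>R incidence_vec (src e) (dst e))"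
proof -
  have "sum f E *v y = (\<Sum>e\<in>E. f e *v y)" for f :: "'n option set \<Rightarrow> real ^ 'n ^ 'n"
    by (induction E rule: infinite_finite_induct) (auto simp: matrix_vector_mult_add_rdistrib)
  then show ?thesis
    by (simp add: reduced_susceptance_laplacian_def outer_product_mult_vec
        scaleR_matrix_vector_assoc[symmetric])
qed

lemma reduced_susceptance_laplacian_selection:
  fixes y :: "real ^ 'n::finite"
  assumes "z \<in> E \<rightarrow>\<^sub>E {0, 1}"
  shows "reduced_susceptance_laplacian E src dst b z *v y =
    (\<Sum>e | e \<in> E \<and> z e = 1.
      (b e * (y \<bullet> incidence_vec (src e) (dst e))) *\<^sub>R incidence_vec (src e) (dst e))"
  unfolding reduced_susceptance_laplacian_mult_vec
  by (rule sum.mono_neutral_cong_right) (use assms in \<open>auto simp: PiE_iff\<close>)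

context incidence_basis
begin

text \<open>
  The column \<open>y\<close> of \<open>X\<close> with index \<open>j\<close> is the potential for a unit current from \<open>j\<close> to the
  reference node. Uniqueness of coefficients turns \<open>L y = axis j 1\<close> into the statement that
  the current \<open>b\<^sub>e (y \<bullet> a\<^sub>e)\<close> through an edge is its crossing number on the path from \<open>j\<close>; the
  potential at \<open>i\<close> is then the sum of the drops along the path from \<open>i\<close>.
\<close>

lemma resistance_matrix_entry:
  fixes X :: "real ^ 'n ^ 'n"
  assumes b: "\<And>e. e \<in> T \<Longrightarrow> b e > 0"
    and L: "\<And>y. L *v y = (\<Sum>e\<in>T. (b e * (y \<bullet> inc e)) *\<^sub>R inc e)"
    and X: "L ** X = mat 1"
    and p: "is_path T (Some i) p None" and q: "is_path T (Some j) q None"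
  shows "X $ i $ j = (\<Sum>e\<in>T. inverse (b e) * (crossing p e * crossing q e))"
proof -
  let ?y = "X *v axis j 1"
  have "(\<Sum>e\<in>T. (b e * (?y \<bullet> inc e)) *\<^sub>R inc e) = axis j 1"
    unfolding L[symmetric] by (simp add: matrix_vector_mul_assoc X)
  also have "\<dots> = (\<Sum>e\<in>T. crossing q e *\<^sub>R inc e)"
    using q by (simp add: is_path_def sum_crossing_inc)
  finally have eq: "(\<Sum>e\<in>T. (b e * (?y \<bullet> inc e)) *\<^sub>R inc e) = (\<Sum>e\<in>T. crossing q e *\<^sub>R inc e)" .
  have drop: "?y \<bullet> inc e = inverse (b e) * crossing q e" if "e \<in> T" for e
  proof -
    have "b e * (?y \<bullet> inc e) = crossing q e"
      by (rule coefficients_unique[OF eq that])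
    then show ?thesis
      using b[OF that] by (simp add: field_simps)
  qed
  have "X $ i $ j = ?y \<bullet> axis i 1"
    by (simp add: matrix_vector_mult_basis column_def inner_axis)
  also have "axis i 1 = (\<Sum>e\<in>T. crossing p e *\<^sub>R inc e)"
    using p by (simp add: is_path_def sum_crossing_inc)
  also have "?y \<bullet> \<dots> = (\<Sum>e\<in>T. crossing p e * (?y \<bullet> inc e))"
    by (simp add: inner_sum_right)
  also have "\<dots> = (\<Sum>e\<in>T. inverse (b e) * (crossing p e * crossing q e))"
    by (rule sum.cong) (auto simp: drop)
  finally show ?thesis .
qed

end

text \<open>
  Every vector is \<open>L (X y)\<close>, a combination of the incidence vectors of the selected edges, and
  the budget bounds the number of these.
\<close>

lemma feasible_imp_incidence_basis:
  fixes E :: "'n::finite option set set"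
  assumes "simple_graph E" and "orientation E src dst"
    and feas: "feasible E src dst b CARD('n) (X, z)"
  shows "incidence_basis {e \<in> E. z e = 1} src dst"
proof
  let ?T = "{e \<in> E. z e = 1}"
  let ?L = "reduced_susceptance_laplacian E src dst b z"
  have z: "z \<in> E \<rightarrow>\<^sub>E {0, 1}" and le: "sum z E \<le> CARD('n)" and X: "?L ** X = mat 1"
    using feas by (auto simp: feasible_def selections_def)
  show "simple_graph ?T" "orientation ?T src dst"
    using assms by (auto simp: simple_graph_def orientation_def)
  have "y \<in> span ((\<lambda>e. incidence_vec (src e) (dst e)) ` ?T)" for y
  proof -
    have "y = ?L *v (X *v y)"
      by (simp add: matrix_vector_mul_assoc X)
    then show ?thesis
      by (subst \<open>y = _\<close>, unfold reduced_susceptance_laplacian_selection[OF z])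
         (intro span_sum span_scale span_base, blast)
  qed
  then show "span ((\<lambda>e. incidence_vec (src e) (dst e)) ` ?T) = (UNIV :: (real ^ 'n) set)"
    by blast
  have "sum z E = (\<Sum>e\<in>?T. 1)"
    by (rule sum.mono_neutral_cong_right) (use z in \<open>auto simp: PiE_iff\<close>)
  then show "card ?T \<le> CARD('n)"
    using le by simp
qed

theorem lemma3:
  fixes E :: "'n::finite option set set"
    and b :: "'n option set \<Rightarrow> real"
    and src dst :: "'n option set \<Rightarrow> 'n option"
    and F :: "'n option set set"
    and w :: "'n option set \<Rightarrow> real"
    and e0 :: "'n option set"
    and X :: "real ^ 'n ^ 'n"
    and z :: "'n option set \<Rightarrow> real"
  assumes "simple_graph E"
    and "\<And>e. e \<in> E \<Longrightarrow> b e > 0"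
    and "orientation E src dst"
    and "simple_graph F" and "connected_graph F"
    and "\<And>e. e \<in> F \<Longrightarrow> w e \<ge> 0"
    and "{e \<in> E. None \<in> e} = {e0}"
    and "is_arg_min (objective (reduced_matrix (laplacian F w))) (feasible E src dst b CARD('n)) (X, z)"
  shows "(\<forall>i. shortest_path_weight E (inverse \<circ> b) (Some i) None \<le> X $ i $ i \<and>
              X $ i $ i \<le> max_spanning_tree_weight E (inverse \<circ> b)) \<and>
         (\<forall>i j. i \<noteq> j \<longrightarrow>
              inverse (b e0) \<le> X $ i $ j \<and>
              X $ i $ j \<le> max_spanning_tree_weight E (inverse \<circ> b) - Min ((inverse \<circ> b) ` E))"
proof -
  define T where "T = {e \<in> E. z e = 1}"
  have feas: "feasible E src dst b CARD('n) (X, z)"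
    using assms(8) by (simp add: is_arg_min_def)
  then have z: "z \<in> E \<rightarrow>\<^sub>E {0, 1}"
    and X: "reduced_susceptance_laplacian E src dst b z ** X = mat 1"
    by (auto simp: feasible_def selections_def)
  interpret incidence_basis T src dst
    unfolding T_def by (rule feasible_imp_incidence_basis[OF assms(1,3) feas])
  let ?x = "inverse \<circ> b"
  let ?f = "max_spanning_tree_weight E ?x"
  have pos: "0 < b e" if "e \<in> T" for e
    using assms(2) that by (simp add: T_def)
  have "spanning_tree E T"
    using connected acyclic by (auto simp: spanning_tree_def T_def)
  then have f: "sum ?x T \<le> ?f"
    by (rule sum_le_max_spanning_tree_weight)
  have "\<forall>i. \<exists>p. is_path T (Some i) p None"
    using connected by (simp add: connected_graph_def)
  then obtain P where P: "\<And>i. is_path T (Some i) (P i) None"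
    by metis
  define s where "s i = crossing (P i)" for i
  have entry: "X $ i $ j = (\<Sum>e\<in>T. inverse (b e) * (s i e * s j e))" for i j
    unfolding s_def
    using resistance_matrix_entry[OF pos _ X P P]
      reduced_susceptance_laplacian_selection[OF z] by (simp add: T_def)
  have s_cases: "s i e \<in> {-1, 0, 1}" for i e
  proof -
    have "distinct (P i)"
      using P[of i] by (simp add: is_path_def)
    then show ?thesis
      unfolding s_def by (rule net_traversals_cases[of _ "src e" "dst e"]) simp_all
  qed
  have s_nonneg: "0 \<le> s i e * s j e" if "e \<in> T" for i j e
    unfolding s_def by (rule crossing_mult_nonneg[OF P P that])
  have s_le: "s i e * s j e \<le> 1" for i j e
    using s_cases[of i e] s_cases[of j e] by fastforce

  have diag: "shortest_path_weight E ?x (Some i) None \<le> X $ i $ i \<and> X $ i $ i \<le> ?f" for i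
  proof
    have "is_path E (Some i) (P i) None"
      using P[of i] unfolding is_path_def adj_list_def T_def
      by (auto elim: successively_mono)
    then have "shortest_path_weight E ?x (Some i) None \<le> path_weight ?x (P i)"
      by (rule shortest_path_weight_le)
    also have "\<dots> = X $ i $ i"
      using P by (simp add: is_path_def path_weight_eq_sum_crossing entry s_def power2_eq_square)
    finally show "shortest_path_weight E ?x (Some i) None \<le> X $ i $ i" .
    have "X $ i $ i \<le> sum ?x T"
      unfolding entry using pos s_le by (intro sum_mono) (simp add: mult_left_le less_imp_le)
    then show "X $ i $ i \<le> ?f"
      using f by simp
  qed

  have "e = e0" if "e \<in> T" "None \<in> e" for e
    using assms(7) that by (auto simp: T_def)
  then obtain c where e0: "e0 \<in> T" "c \<noteq> 0" "s i e0 = c" for i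
    using crossing_only_edge_at_root P unfolding s_def by metis
  have off_diag_lower: "inverse (b e0) \<le> X $ i $ j" for i j
  proof -
    have "s i e0 * s j e0 = 1"
      using e0 s_cases[of i e0] by auto
    then have "inverse (b e0) = inverse (b e0) * (s i e0 * s j e0)"
      by simp
    also have "\<dots> \<le> X $ i $ j"
      unfolding entry using e0(1) pos s_nonneg
      by (intro member_le_sum) (auto simp: less_imp_le)
    finally show ?thesis .
  qed

  have off_diag_upper: "X $ i $ j \<le> ?f - Min (?x ` E)" if "i \<noteq> j" for i j
  proof -
    \<comment> \<open>Equal signs on all edges would make the start nodes equal, so some edge is not shared.\<close>
    have "\<exists>e\<in>T. s i e \<noteq> s j e"
    proof (rule ccontr)
      assume "\<not> ?thesis"
      then have "(\<Sum>e\<in>T. s i e *\<^sub>R inc e) = (\<Sum>e\<in>T. s j e *\<^sub>R inc e)"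
        by simp
      then have "node_vec (Some i) = node_vec (Some j)"
        using P[of i] P[of j] unfolding s_def by (simp add: is_path_def sum_crossing_inc)
      then show False
        using that by (simp only: node_vec_inject) simp
    qed
    then obtain e where e: "e \<in> T" "s i e \<noteq> s j e"
      by blast
    then have "s i e * s j e = 0"
      using s_cases[of i e] s_cases[of j e] s_nonneg[OF e(1), of i j] by auto
    then have "X $ i $ j = (\<Sum>e\<in>T - {e}. inverse (b e) * (s i e * s j e))"
      unfolding entry using e(1) by (simp add: sum.remove)
    also have "\<dots> \<le> sum ?x (T - {e})"
      using pos s_le by (intro sum_mono) (simp add: mult_left_le less_imp_le)
    also have "\<dots> = sum ?x T - ?x e"
      using e(1) by (simp add: sum_diff1)
    also have "\<dots> \<le> ?f - Min (?x ` E)"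
      using f e(1) by (intro diff_mono Min_le) (auto simp: T_def)
    finally show ?thesis .
  qed
  show ?thesis
    using diag off_diag_lower off_diag_upper by blast
qed

end
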